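(* Fix a positive integer $k_A$. Let $D(k_B)$ be the minimum positive integer $\Delta$ such that $K_{\Delta,\Delta}$ is not $(k_A,k_B)$-choosable. Then $D(k_B) \sim \xi_m(k_A)\, k_B^{k_A}/(k_A \log k_B)^{k_A-1}$ as $k_B \to \infty$.
   Context: All graphs are finite and simple. For a bipartite graph $G$ with bipartition $V = A \sqcup B$ and positive integers $k_A, k_B$, $G$ is $(k_A,k_B)$-choosable if for every set of colors $C$ and every list assignment $L$ assigning to each vertex of $A$ a $k_A$-element subset of $C$ and to each vertex of $B$ a $k_B$-element subset of $C$, there is a map $c\colon V\to C$ with $c(v)\in L(v)$ for all $v$ and $c(v)\neq c(v')$ for every edge $vv'$. For the complete bipartite graph $K_{\Delta_B,\Delta_A}$ the part $A$ has $\Delta_B$ vertices and the part $B$ has $\Delta_A$ vertices. $\log$ is the natural logarithm, with the convention $(\log x)^0=1$. For positive integers $\Delta_A,\Delta_B,k_A,k_B$ let $\xi = \Delta_B(\log\Delta_A)^{k_A-1}/k_B^{k_A}$, and let $\xi_m(k_A)$ be the infimum of $\xi$ over all positive integers $\Delta_A,\Delta_B,k_B$ such that $K_{\Delta_B,\Delta_A}$ is not $(k_A,k_B)$-choosable. $f\sim g$ means $f/g\to 1$. *)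

theory Defs
  imports Complex_Main
begin

locale bipartite_graph =
  fixes A B :: "'v set" and E :: "'v set set"
  assumes finite_A: "finite A"
    and finite_B: "finite B"
    and disjoint: "A \<inter> B = {}"
    and edges: "E \<subseteq> {{a, b} | a b. a \<in> A \<and> b \<in> B}"
begin

text \<open>
  Colours are natural numbers. Since \<open>A \<union> B\<close> is finite and the lists are finite, this is
  no restriction: see \<open>choosable_any_colours\<close> below.
\<close>

definition choosable :: "nat \<Rightarrow> nat \<Rightarrow> bool" where
  "choosable kA kB \<longleftrightarrow>
    (\<forall>(C :: nat set) (L :: 'v \<Rightarrow> nat set).
      (\<forall>v\<in>A. L v \<subseteq> C \<and> finite (L v) \<and> card (L v) = kA) \<longrightarrow>
      (\<forall>v\<in>B. L v \<subseteq> C \<and> finite (L v) \<and> card (L v) = kB) \<longrightarrow>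
      (\<exists>c :: 'v \<Rightarrow> nat. (\<forall>v\<in>A \<union> B. c v \<in> L v) \<and>
        (\<forall>v\<in>A \<union> B. \<forall>v'\<in>A \<union> B. {v, v'} \<in> E \<longrightarrow> c v \<noteq> c v')))"

lemma choosable_any_colours:
  fixes C :: "'c set" and L :: "'v \<Rightarrow> 'c set"
  assumes ch: "choosable kA kB"
    and LA: "\<forall>v\<in>A. L v \<subseteq> C \<and> finite (L v) \<and> card (L v) = kA"
    and LB: "\<forall>v\<in>B. L v \<subseteq> C \<and> finite (L v) \<and> card (L v) = kB"
  shows "\<exists>c :: 'v \<Rightarrow> 'c. (\<forall>v\<in>A \<union> B. c v \<in> L v) \<and>
    (\<forall>v\<in>A \<union> B. \<forall>v'\<in>A \<union> B. {v, v'} \<in> E \<longrightarrow> c v \<noteq> c v')"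
proof -
  define U where "U = (\<Union>v\<in>A \<union> B. L v)"
  have "finite U"
    unfolding U_def using LA LB finite_A finite_B by blast
  then obtain f :: "'c \<Rightarrow> nat" where f: "inj_on f U"
    using finite_imp_inj_to_nat_seg by blast
  have sub: "L v \<subseteq> U" if "v \<in> A \<union> B" for v
    using that unfolding U_def by blast
  have card_f: "card (f ` L v) = card (L v)" if "v \<in> A \<union> B" for v
    using that sub f by (meson card_image inj_on_subset)
  have "\<exists>c. (\<forall>v\<in>A \<union> B. c v \<in> f ` L v) \<and>
      (\<forall>v\<in>A \<union> B. \<forall>v'\<in>A \<union> B. {v, v'} \<in> E \<longrightarrow> c v \<noteq> c v')"
    using LA LB card_f
    by (intro ch[unfolded choosable_def, rule_format, of "\<lambda>v. f ` L v" UNIV]) auto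
  then obtain c where c: "\<forall>v\<in>A \<union> B. c v \<in> f ` L v"
    and proper: "\<forall>v\<in>A \<union> B. \<forall>v'\<in>A \<union> B. {v, v'} \<in> E \<longrightarrow> c v \<noteq> c v'"
    by blast
  from c have "\<forall>v\<in>A \<union> B. \<exists>x. x \<in> L v \<and> f x = c v"
    by (metis imageE)
  then obtain d where d: "\<forall>v\<in>A \<union> B. d v \<in> L v \<and> f (d v) = c v"
    by metis
  have "\<forall>v\<in>A \<union> B. \<forall>v'\<in>A \<union> B. {v, v'} \<in> E \<longrightarrow> d v \<noteq> d v'"
    using d proper by metis
  with d show ?thesis by blast
qed

end

definition K_A :: "nat \<Rightarrow> (nat + nat) set" where
  "K_A m = Inl ` {..<m}"

definition K_B :: "nat \<Rightarrow> (nat + nat) set" where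
  "K_B n = Inr ` {..<n}"

definition K_E :: "nat \<Rightarrow> nat \<Rightarrow> (nat + nat) set set" where
  "K_E m n = {{a, b} | a b. a \<in> K_A m \<and> b \<in> K_B n}"

lemma bipartite_graph_K: "bipartite_graph (K_A m) (K_B n) (K_E m n)"
  by unfold_locales (auto simp: K_A_def K_B_def K_E_def)

text \<open>\<open>K_choosable m n kA kB\<close>: the graph \<open>K\<^bsub>m,n\<^esub>\<close>, whose parts \<open>A\<close> and \<open>B\<close> have
  \<open>m\<close> and \<open>n\<close> vertices respectively, is \<open>(kA, kB)\<close>-choosable.\<close>

definition K_choosable :: "nat \<Rightarrow> nat \<Rightarrow> nat \<Rightarrow> nat \<Rightarrow> bool" where
  "K_choosable m n = bipartite_graph.choosable (K_A m) (K_B n) (K_E m n)"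

definition xi :: "nat \<Rightarrow> nat \<Rightarrow> nat \<Rightarrow> nat \<Rightarrow> real" where
  "xi \<Delta>A \<Delta>B kA kB = real \<Delta>B * ln (real \<Delta>A) ^ (kA - 1) / real kB ^ kA"

text \<open>The part \<open>A\<close> has \<open>\<Delta>B\<close> vertices and the part \<open>B\<close> has \<open>\<Delta>A\<close>: the subscripts refer to
  the degrees of the vertices.\<close>

definition xi_m :: "nat \<Rightarrow> real" where
  "xi_m kA = Inf {xi \<Delta>A \<Delta>B kA kB | \<Delta>A \<Delta>B kB.
     0 < \<Delta>A \<and> 0 < \<Delta>B \<and> 0 < kB \<and> \<not> K_choosable \<Delta>B \<Delta>A kA kB}"

definition D :: "nat \<Rightarrow> nat \<Rightarrow> nat" where
  "D kA kB = (LEAST \<Delta>. 0 < \<Delta> \<and> \<not> K_choosable \<Delta> \<Delta> kA kB)"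

end

(*
  A list assignment is a pair of hypergraphs H (the lists on A) and F (the lists on B) on the
  colours, and a colouring exists iff some set S of colours contains no edge of H and meets every
  edge of F: let S be the complement of the colours used on A.
  From one non-choosable example (m, n, b), t disjoint copies with s clones of each colour give
  the example (s^k t m, n^t, s t b) with the same xi. Taking t close to k log b / log n turns any
  example into one on the diagonal, which bounds D from above by nearly optimal values of xi.
  The bound from below is the definition of xi_m applied to D itself, since log D is at most
  k log b + O(1). That xi_m is positive follows by taking a random set of colours of density
  8 log n / b and deleting one colour from each edge of H inside it.
*)

theory Submission
  imports Defs "HOL-Library.FuncSet" "HOL-Real_Asymp.Real_Asymp"
begin

section \<open>Choosability in terms of hypergraphs\<close>

text \<open>Pads an enumeration of \<open>X\<close> by repeating its first element, so that a family
  of at most \<open>m\<close> sets can serve as the lists of exactly \<open>m\<close>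
  vertices.\<close>

lemma finite_surj_lessThan:
  assumes "finite X" "X \<noteq> {}" "card X \<le> m"
  obtains p where "p ` {..<m} = X"
proof -
  obtain h where h: "bij_betw h {0..<card X} X"
    using ex_bij_betw_nat_finite[OF assms(1)] by blast
  have pos: "card X > 0" using assms by (simp add: card_gt_0_iff)
  have im: "h ` {0..<card X} = X" using h by (simp add: bij_betw_def)
  have "(\<lambda>i. if i < card X then h i else h 0) ` {..<m} = X"
  proof
    show "(\<lambda>i. if i < card X then h i else h 0) ` {..<m} \<subseteq> X"
      using im pos by auto
    show "X \<subseteq> (\<lambda>i. if i < card X then h i else h 0) ` {..<m}"
    proof
      fix x assume "x \<in> X"
      then obtain i where i: "i < card X" "x = h i" using im by (metis atLeastLessThan_iff imageE)
      show "x \<in> (\<lambda>i. if i < card X then h i else h 0) ` {..<m}"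
        by (rule image_eqI[of _ _ i]) (use i assms(3) in auto)
    qed
  qed
  then show thesis by (rule that)
qed

text \<open>\<open>S\<close> stands for the colours reserved for the part \<open>B\<close>. It may
  contain colours that occur in no list, so complements are allowed.\<close>

definition independent_transversal :: "'c set set \<Rightarrow> 'c set set \<Rightarrow> 'c set \<Rightarrow> bool" where
  "independent_transversal H F S \<longleftrightarrow> (\<forall>e\<in>H. \<not> e \<subseteq> S) \<and> (\<forall>f\<in>F. f \<inter> S \<noteq> {})"

text \<open>The sizes enter as inequalities, with \<open>b \<le> card f\<close> for the lists on
  \<open>B\<close>, so that constructions need not meet them exactly.\<close>

lemma K_choosable_independent_transversal:
  fixes H F :: "'c set set"
  assumes ch: "K_choosable m n k b"
    and H: "finite H" "H \<noteq> {}" "card H \<le> m" "\<And>e. e \<in> H \<Longrightarrow> finite e \<and> card e = k"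
    and F: "finite F" "F \<noteq> {}" "card F \<le> n" "\<And>f. f \<in> F \<Longrightarrow> finite f \<and> b \<le> card f"
  shows "\<exists>S. independent_transversal H F S"
proof -
  obtain p where p: "p ` {..<m} = H" using finite_surj_lessThan[OF H(1-3)] by blast
  obtain q where q: "q ` {..<n} = F" using finite_surj_lessThan[OF F(1-3)] by blast
  \<comment> \<open>Lists on \<open>B\<close> are cut down to exactly \<open>b\<close> colours; a
    set that meets the smaller list meets \<open>f\<close>.\<close>
  have "\<forall>f\<in>F. \<exists>g. g \<subseteq> f \<and> card g = b \<and> finite g"
    using F(4) by (meson obtain_subset_with_card_n)
  then obtain g where g: "\<And>f. f \<in> F \<Longrightarrow> g f \<subseteq> f \<and> card (g f) = b \<and> finite (g f)"
    by metis
  define L where "L = case_sum p (\<lambda>j. g (q j))"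
  have LA: "\<forall>v\<in>K_A m. L v \<subseteq> UNIV \<and> finite (L v) \<and> card (L v) = k"
    using H(4) p by (auto simp: K_A_def L_def)
  have LB: "\<forall>v\<in>K_B n. L v \<subseteq> UNIV \<and> finite (L v) \<and> card (L v) = b"
    using g q by (auto simp: K_B_def L_def)
  obtain c where c: "\<forall>v\<in>K_A m \<union> K_B n. c v \<in> L v"
    and proper: "\<forall>v\<in>K_A m \<union> K_B n. \<forall>v'\<in>K_A m \<union> K_B n. {v, v'} \<in> K_E m n \<longrightarrow> c v \<noteq> c v'"
    using bipartite_graph.choosable_any_colours
      [OF bipartite_graph_K ch[unfolded K_choosable_def] LA LB] by blast
  have ne: "c (Inl i) \<noteq> c (Inr j)" if "i < m" "j < n" for i j
    using proper that unfolding K_E_def K_A_def K_B_def by blast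
  have ca: "c (Inl i) \<in> p i" if "i < m" for i
  proof -
    have "c (Inl i) \<in> L (Inl i)" using c that unfolding K_A_def by blast
    then show ?thesis by (simp add: L_def)
  qed
  have cb: "c (Inr j) \<in> q j" if "j < n" for j
  proof -
    have "c (Inr j) \<in> g (q j)" using c[rule_format, of "Inr j"] that by (simp add: K_B_def L_def)
    then show ?thesis using g q that by blast
  qed
  have "independent_transversal H F (- ((\<lambda>i. c (Inl i)) ` {..<m}))"
    unfolding independent_transversal_def
  proof (intro conjI ballI)
    fix e assume "e \<in> H"
    then obtain i where "i < m" "e = p i" using p by auto
    then show "\<not> e \<subseteq> - ((\<lambda>i. c (Inl i)) ` {..<m})" using ca by blast
  next
    fix f assume "f \<in> F"
    then obtain j where j: "j < n" "f = q j" using q by auto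
    then have "c (Inr j) \<in> f \<inter> - ((\<lambda>i. c (Inl i)) ` {..<m})" using cb ne by force
    then show "f \<inter> - ((\<lambda>i. c (Inl i)) ` {..<m}) \<noteq> {}" by blast
  qed
  then show ?thesis by blast
qed

text \<open>Take the lists of a bad assignment as \<open>H\<close> and \<open>F\<close>. From a set
  \<open>S\<close>, colouring \<open>B\<close> inside \<open>S\<close> and \<open>A\<close> outside
  \<open>S\<close> would give a proper colouring.\<close>

lemma not_K_choosable_hypergraphs:
  assumes nch: "\<not> K_choosable m n k b" and "0 < m" "0 < n"
  obtains H F :: "nat set set" where
    "finite H" "H \<noteq> {}" "card H \<le> m" "\<And>e. e \<in> H \<Longrightarrow> finite e \<and> card e = k"
    "finite F" "F \<noteq> {}" "card F \<le> n" "\<And>f. f \<in> F \<Longrightarrow> finite f \<and> card f = b"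
    "\<nexists>S. independent_transversal H F S"
proof -
  obtain C and L :: "nat + nat \<Rightarrow> nat set" where
    LA: "\<forall>v\<in>K_A m. L v \<subseteq> C \<and> finite (L v) \<and> card (L v) = k" and
    LB: "\<forall>v\<in>K_B n. L v \<subseteq> C \<and> finite (L v) \<and> card (L v) = b" and
    no: "\<nexists>c. (\<forall>v\<in>K_A m \<union> K_B n. c v \<in> L v) \<and>
       (\<forall>v\<in>K_A m \<union> K_B n. \<forall>v'\<in>K_A m \<union> K_B n. {v, v'} \<in> K_E m n \<longrightarrow> c v \<noteq> c v')"
    using nch
    unfolding K_choosable_def bipartite_graph.choosable_def[OF bipartite_graph_K] not_all not_imp
    by (elim exE conjE) (rule that)
  have "\<not> independent_transversal (L ` K_A m) (L ` K_B n) S" for S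
  proof
    assume S: "independent_transversal (L ` K_A m) (L ` K_B n) S"
    define c where "c v = (SOME x. x \<in> L v \<and> (x \<in> S \<longleftrightarrow> v \<in> K_B n))" for v
    have ex: "\<exists>x. x \<in> L v \<and> (x \<in> S \<longleftrightarrow> v \<in> K_B n)" if "v \<in> K_A m \<union> K_B n" for v
      using that S unfolding independent_transversal_def K_A_def K_B_def by fastforce
    have c: "c v \<in> L v \<and> (c v \<in> S \<longleftrightarrow> v \<in> K_B n)" if "v \<in> K_A m \<union> K_B n" for v
      unfolding c_def by (rule someI_ex[OF ex[OF that]])
    have "c v \<noteq> c v'" if "v \<in> K_A m \<union> K_B n" "v' \<in> K_A m \<union> K_B n" "{v, v'} \<in> K_E m n" for v v'
    proof -
      have "(v \<in> K_B n) \<noteq> (v' \<in> K_B n)"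
        using that(3) by (auto simp: K_E_def K_A_def K_B_def doubleton_eq_iff)
      then show ?thesis using c[OF that(1)] c[OF that(2)] by auto
    qed
    then show False using no c by blast
  qed
  moreover have "card (L ` K_A m) \<le> m" "card (L ` K_B n) \<le> n"
    unfolding K_A_def K_B_def image_image by (metis card_image_le card_lessThan finite_lessThan)+
  ultimately show thesis
    using LA LB assms(2,3)
    by (intro that[of "L ` K_A m" "L ` K_B n"]) (auto simp: K_A_def K_B_def)
qed

text \<open>The same pair of hypergraphs witnesses both failures, because
  \<open>K_choosable_independent_transversal\<close> asks only for inequalities.\<close>

lemma not_K_choosable_mono:
  assumes "\<not> K_choosable m n k b" "0 < m" "0 < n" "m \<le> m'" "n \<le> n'" "b' \<le> b"
  shows "\<not> K_choosable m' n' k b'"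
proof
  assume ch: "K_choosable m' n' k b'"
  obtain H F :: "nat set set" where
    H: "finite H" "H \<noteq> {}" "card H \<le> m" "\<And>e. e \<in> H \<Longrightarrow> finite e \<and> card e = k" and
    F: "finite F" "F \<noteq> {}" "card F \<le> n" "\<And>f. f \<in> F \<Longrightarrow> finite f \<and> card f = b" and
    no: "\<nexists>S. independent_transversal H F S"
    by (rule not_K_choosable_hypergraphs[OF assms(1-3)]) blast
  have "\<exists>S. independent_transversal H F S"
    by (rule K_choosable_independent_transversal[OF ch])
      (use H F assms(4-6) in \<open>auto intro: order_trans\<close>)
  then show False using no by blast
qed

section \<open>Blowing up a non-choosable example\<close>

text \<open>
  Take \<open>t\<close> disjoint copies of the example and replace each colour by \<open>s\<close> clones. An edge of the
  new \<open>k\<close>-uniform hypergraph is an edge of one copy with a clone chosen for each of its colours;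
  a long list consists of all clones of one list from each copy.
\<close>

lemma not_K_choosable_blowup:
  assumes nch: "\<not> K_choosable m n k b" and pos: "0 < m" "0 < n" "0 < s" "0 < t"
  shows "\<not> K_choosable (s ^ k * t * m) (n ^ t) k (s * t * b)"
proof
  assume ch: "K_choosable (s ^ k * t * m) (n ^ t) k (s * t * b)"
  obtain H F :: "nat set set" where
    H: "finite H" "H \<noteq> {}" "card H \<le> m" "\<And>e. e \<in> H \<Longrightarrow> finite e \<and> card e = k" and
    F: "finite F" "F \<noteq> {}" "card F \<le> n" "\<And>f. f \<in> F \<Longrightarrow> finite f \<and> card f = b" and
    no: "\<nexists>S. independent_transversal H F S"
    by (rule not_K_choosable_hypergraphs[OF nch pos(1,2)]) blast
  \<comment> \<open>A new colour \<open>(c, i, j)\<close> is clone \<open>j\<close> of the colour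
    \<open>c\<close> in copy \<open>i\<close>. \<open>I\<close> indexes the new edges and
    \<open>J\<close> the long lists.\<close>
  define I where "I = {..<t} \<times> (SIGMA e:H. e \<rightarrow>\<^sub>E {..<s})"
  define E where "E = (\<lambda>(i, e, \<phi>). (\<lambda>c. (c, i, \<phi> c)) ` e :: (nat \<times> nat \<times> nat) set)"
  define J where "J = ({..<t} \<rightarrow>\<^sub>E F)"
  define G where "G = (\<lambda>\<psi> :: nat \<Rightarrow> nat set. SIGMA c:UNIV. {i. i < t \<and> c \<in> \<psi> i} \<times> {..<s})"
  have finJ: "finite J" unfolding J_def using F(1) by (intro finite_PiE) auto
  have finI: "finite I"
    unfolding I_def using H by (intro finite_cartesian_product finite_SigmaI finite_PiE) auto
  have cardI: "card I \<le> s ^ k * t * m"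
  proof -
    have "card (SIGMA e:H. e \<rightarrow>\<^sub>E {..<s}) = (\<Sum>e\<in>H. card (e \<rightarrow>\<^sub>E {..<s}))"
      using H by (intro card_SigmaI) (auto intro!: finite_PiE)
    also have "\<dots> = (\<Sum>e\<in>H. s ^ k)"
      using H by (intro sum.cong) (auto simp: card_PiE)
    also have "\<dots> = card H * s ^ k" by simp
    also have "\<dots> \<le> m * s ^ k" using H(3) by simp
    finally show ?thesis unfolding I_def card_cartesian_product by (simp add: ac_simps)
  qed
  have cardJ: "card J \<le> n ^ t"
    unfolding J_def by (simp add: card_PiE F(3) power_mono)
  have "\<exists>S. independent_transversal (E ` I) (G ` J) S"
  proof (rule K_choosable_independent_transversal[OF ch])
    show "finite (E ` I)" "finite (G ` J)" using finI finJ by auto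
    show "card (E ` I) \<le> s ^ k * t * m" using card_image_le[OF finI, of E] cardI by linarith
    show "card (G ` J) \<le> n ^ t" using card_image_le[OF finJ, of G] cardJ by linarith
    obtain e where e: "e \<in> H" using H(2) by blast
    have "(0, e, restrict (\<lambda>_. 0) e) \<in> I" unfolding I_def using e pos by auto
    then show "E ` I \<noteq> {}" by blast
    obtain f where f: "f \<in> F" using F(2) by blast
    then have "restrict (\<lambda>_. f) {..<t} \<in> J" unfolding J_def by auto
    then show "G ` J \<noteq> {}" by blast
  next
    fix e' assume "e' \<in> E ` I"
    then obtain i e \<phi> where e: "e \<in> H" and e': "e' = (\<lambda>c. (c, i, \<phi> c)) ` e"
      unfolding E_def I_def by auto
    have "inj_on (\<lambda>c. (c, i, \<phi> c)) e" by (auto simp: inj_on_def)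
    then show "finite e' \<and> card e' = k" unfolding e' using H(4)[OF e] by (simp add: card_image)
  next
    fix f' assume "f' \<in> G ` J"
    then obtain \<psi> where \<psi>: "\<psi> \<in> J" and f': "f' = G \<psi>" by blast
    have \<psi>F: "\<psi> i \<in> F" if "i < t" for i using \<psi> that unfolding J_def by auto
    have G_eq: "G \<psi> = (\<lambda>(i, c, j). (c, i, j)) ` (SIGMA i:{..<t}. \<psi> i \<times> {..<s})"
      unfolding G_def by force
    have fin: "finite (SIGMA i:{..<t}. \<psi> i \<times> {..<s})"
      using \<psi>F F(4) by auto
    have "inj_on (\<lambda>(i, c, j). (c, i, j)) (SIGMA i:{..<t}. \<psi> i \<times> {..<s})"
      by (auto simp: inj_on_def)
    then have "card (G \<psi>) = card (SIGMA i:{..<t}. \<psi> i \<times> {..<s})"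
      unfolding G_eq by (rule card_image)
    also have "\<dots> = (\<Sum>i<t. card (\<psi> i \<times> {..<s}))"
      using \<psi>F F(4) by (intro card_SigmaI) auto
    also have "\<dots> = (\<Sum>i<t. b * s)"
      using \<psi>F F(4) by (intro sum.cong) (auto simp: card_cartesian_product)
    also have "\<dots> = s * t * b" by simp
    finally show "finite f' \<and> s * t * b \<le> card f'" using fin unfolding f' G_eq by simp
  qed
  then obtain S where S: "independent_transversal (E ` I) (G ` J) S" by blast
  \<comment> \<open>\<open>T\<close> collects the colours with a clone in \<open>S\<close> in copy
    \<open>i\<close>. An edge of \<open>H\<close> inside \<open>T\<close> would yield a new edge
    inside \<open>S\<close>, so \<open>T\<close> misses some list of \<open>F\<close>. The lists
    found in all copies together form a long list disjoint from \<open>S\<close>.\<close>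
  have "\<exists>f\<in>F. \<forall>c\<in>f. \<forall>j<s. (c, i, j) \<notin> S" if i: "i < t" for i
  proof -
    define T where "T = {c. \<exists>j<s. (c, i, j) \<in> S}"
    have "\<not> e \<subseteq> T" if e: "e \<in> H" for e
    proof
      assume "e \<subseteq> T"
      then have "\<forall>c\<in>e. \<exists>j. j < s \<and> (c, i, j) \<in> S" unfolding T_def by blast
      then obtain \<phi> where \<phi>: "\<forall>c\<in>e. \<phi> c < s \<and> (c, i, \<phi> c) \<in> S" by metis
      have "(i, e, restrict \<phi> e) \<in> I" unfolding I_def using i e \<phi> by auto
      then have "\<not> E (i, e, restrict \<phi> e) \<subseteq> S"
        using S unfolding independent_transversal_def by blast
      then show False using \<phi> unfolding E_def by auto
    qed
    then obtain f where "f \<in> F" "f \<inter> T = {}"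
      using no unfolding independent_transversal_def by blast
    then show ?thesis unfolding T_def by blast
  qed
  then obtain \<psi> where \<psi>: "\<And>i. i < t \<Longrightarrow> \<psi> i \<in> F \<and> (\<forall>c\<in>\<psi> i. \<forall>j<s. (c, i, j) \<notin> S)"
    by metis
  have "restrict \<psi> {..<t} \<in> J" unfolding J_def using \<psi> by auto
  then have "G (restrict \<psi> {..<t}) \<inter> S \<noteq> {}"
    using S unfolding independent_transversal_def by blast
  then show False using \<psi> unfolding G_def by (auto split: if_splits)
qed

section \<open>The infimum is positive\<close>

text \<open>Removing one vertex from every edge inside \<open>R\<close> destroys all these edges and
  costs at most as many vertices as there are edges, so part of each \<open>R \<inter> f\<close>
  survives.\<close>

lemma independent_transversal_deletion:
  assumes "finite H" and ne: "\<And>e. e \<in> H \<Longrightarrow> e \<noteq> {}"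
    and fin: "\<And>f. f \<in> F \<Longrightarrow> finite f"
    and less: "\<And>f. f \<in> F \<Longrightarrow> card {e \<in> H. e \<subseteq> R} < card (R \<inter> f)"
  shows "\<exists>S. independent_transversal H F S"
proof -
  obtain v where v: "\<And>e. e \<in> H \<Longrightarrow> v e \<in> e" using ne by (metis ex_in_conv)
  define X where "X = {e \<in> H. e \<subseteq> R}"
  have finX: "finite X" unfolding X_def using assms(1) by simp
  have "independent_transversal H F (R - v ` X)"
    unfolding independent_transversal_def
  proof (intro conjI ballI)
    fix e assume "e \<in> H" then show "\<not> e \<subseteq> R - v ` X" using v unfolding X_def by blast
  next
    fix f assume f: "f \<in> F"
    have "\<not> R \<inter> f \<subseteq> v ` X"
      using less[OF f] card_image_le[OF finX, of v] card_mono[of "v ` X" "R \<inter> f"] finX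
      unfolding X_def by fastforce
    then show "f \<inter> (R - v ` X) \<noteq> {}" by blast
  qed
  then show ?thesis by blast
qed

text \<open>
  A random set \<open>R\<close> containing each colour independently with probability \<open>p\<close>. The hypothesis
  says that \<open>X / l + (\<Sum>f\<in>F. 2 powr (l - \<bar>R \<inter> f\<bar>))\<close>, where \<open>X\<close> counts the edges inside \<open>R\<close>,
  has expectation below 1; where it is below 1, \<open>X < l < \<bar>R \<inter> f\<bar>\<close> for all \<open>f\<close>.
\<close>

lemma independent_transversal_random:
  fixes H F :: "'c set set" and p l :: real
  assumes H: "finite H" "\<And>e. e \<in> H \<Longrightarrow> finite e \<and> card e = k" and "0 < k"
    and F: "finite F" "\<And>f. f \<in> F \<Longrightarrow> finite f \<and> card f = b"
    and p: "0 \<le> p" "p \<le> 1" and l: "0 < l"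
    and small: "card H * p ^ k / l + card F * (2 powr l * (1 - p / 2) ^ b) < 1"
  shows "\<exists>S. independent_transversal H F S"
proof -
  define V where "V = \<Union>H \<union> \<Union>F"
  have finV: "finite V" unfolding V_def using H F by auto
  \<comment> \<open>\<open>w R\<close> is the probability that the random subset of \<open>V\<close>
    is \<open>R\<close>. Expectations are weighted sums over \<open>Pow V\<close>, evaluated by
    reading \<open>prod_add\<close> from right to left.\<close>
  define w where "w R = (\<Prod>v\<in>R. p) * (\<Prod>v\<in>V - R. 1 - p)" for R :: "'c set"
  have w0: "w R \<ge> 0" for R unfolding w_def using p by (intro mult_nonneg_nonneg prod_nonneg) auto
  define \<Phi> where "\<Phi> R = card {e \<in> H. e \<subseteq> R} / l + (\<Sum>f\<in>F. 2 powr l * (1/2) ^ card (R \<inter> f))"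
    for R :: "'c set"
  have w1: "(\<Sum>R\<in>Pow V. w R) = 1"
    unfolding w_def using prod_add[OF finV, of "\<lambda>_. p" "\<lambda>_. 1 - p"] by simp
  have edge: "(\<Sum>R\<in>Pow V. w R * of_bool (e \<subseteq> R)) = p ^ k" if e: "e \<in> H" for e
  proof -
    have eV: "e \<subseteq> V" using e unfolding V_def by blast
    \<comment> \<open>The indicator is absorbed into the product: leaving out a vertex of
      \<open>e\<close> gets the factor 0.\<close>
    have "(\<Sum>R\<in>Pow V. w R * of_bool (e \<subseteq> R))
       = (\<Sum>R\<in>Pow V. (\<Prod>v\<in>R. p) * (\<Prod>v\<in>V - R. if v \<in> e then 0 else 1 - p))"
    proof (rule sum.cong[OF refl])
      fix R assume R: "R \<in> Pow V"
      show "w R * of_bool (e \<subseteq> R) = (\<Prod>v\<in>R. p) * (\<Prod>v\<in>V - R. if v \<in> e then 0 else 1 - p)"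
      proof (cases "e \<subseteq> R")
        case True
        then have "(\<Prod>v\<in>V - R. if v \<in> e then 0 else 1 - p) = (\<Prod>v\<in>V - R. 1 - p)"
          by (intro prod.cong) auto
        then show ?thesis using True by (simp add: w_def)
      next
        case False
        then obtain v where "v \<in> e" "v \<in> V - R" using eV by blast
        then have "(\<Prod>v\<in>V - R. if v \<in> e then 0 else 1 - p) = 0"
          using finV by (intro prod_zero) auto
        then show ?thesis using False by simp
      qed
    qed
    also have "\<dots> = (\<Prod>v\<in>V. p + (if v \<in> e then 0 else 1 - p))"
      using prod_add[OF finV, of "\<lambda>_. p" "\<lambda>v. if v \<in> e then 0 else 1 - p"] by simp
    also have "\<dots> = (\<Prod>v\<in>V. if v \<in> e then p else 1)" by (intro prod.cong) auto
    also have "\<dots> = (\<Prod>v\<in>e. p)"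
      using eV finV by (subst prod.inter_restrict[symmetric]) (auto simp: Int_absorb1)
    finally show ?thesis using H(2)[OF e] by simp
  qed
  have hit: "(\<Sum>R\<in>Pow V. w R * (1/2) ^ card (R \<inter> f)) = (1 - p / 2) ^ b" if f: "f \<in> F" for f
  proof -
    have fV: "f \<subseteq> V" using f unfolding V_def by blast
    \<comment> \<open>Each vertex of \<open>f\<close> chosen into \<open>R\<close> carries an extra
      factor 1/2, so it contributes \<open>p / 2 + (1 - p)\<close> in total.\<close>
    have "(\<Sum>R\<in>Pow V. w R * (1/2) ^ card (R \<inter> f))
       = (\<Sum>R\<in>Pow V. (\<Prod>v\<in>R. p * (if v \<in> f then 1/2 else 1)) * (\<Prod>v\<in>V - R. 1 - p))"
    proof (rule sum.cong[OF refl])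
      fix R assume "R \<in> Pow V"
      then have "finite R" using finV finite_subset by blast
      then have "(\<Prod>v\<in>R. if v \<in> f then 1/2 else 1 :: real) = (1/2) ^ card (R \<inter> f)"
        by (subst prod.inter_restrict[symmetric]) auto
      then show "w R * (1/2) ^ card (R \<inter> f)
          = (\<Prod>v\<in>R. p * (if v \<in> f then 1/2 else 1)) * (\<Prod>v\<in>V - R. 1 - p)"
        unfolding w_def by (simp add: prod.distrib)
    qed
    also have "\<dots> = (\<Prod>v\<in>V. p * (if v \<in> f then 1/2 else 1) + (1 - p))"
      using prod_add[OF finV, of "\<lambda>v. p * (if v \<in> f then 1/2 else 1)" "\<lambda>_. 1 - p"] by simp
    also have "\<dots> = (\<Prod>v\<in>V. if v \<in> f then 1 - p / 2 else 1)" by (intro prod.cong) auto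
    also have "\<dots> = (\<Prod>v\<in>f. 1 - p / 2)"
      using fV finV by (subst prod.inter_restrict[symmetric]) (auto simp: Int_absorb1)
    finally show ?thesis using F(2)[OF f] by simp
  qed
  have "(\<Sum>R\<in>Pow V. w R * \<Phi> R)
     = (\<Sum>R\<in>Pow V. (\<Sum>e\<in>H. w R * of_bool (e \<subseteq> R) / l)
         + (\<Sum>f\<in>F. 2 powr l * (w R * (1/2) ^ card (R \<inter> f))))"
  proof (rule sum.cong[OF refl])
    fix R
    have "real (card {e \<in> H. e \<subseteq> R}) = (\<Sum>e\<in>H. of_bool (e \<subseteq> R))"
      using H(1) by (simp add: Int_def)
    then show "w R * \<Phi> R = (\<Sum>e\<in>H. w R * of_bool (e \<subseteq> R) / l)
         + (\<Sum>f\<in>F. 2 powr l * (w R * (1/2) ^ card (R \<inter> f)))"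
      unfolding \<Phi>_def
      by (simp only: distrib_left sum_distrib_left sum_divide_distrib times_divide_eq_right)
        (simp add: ac_simps)
  qed
  also have "\<dots> = (\<Sum>e\<in>H. \<Sum>R\<in>Pow V. w R * of_bool (e \<subseteq> R) / l)
       + (\<Sum>f\<in>F. \<Sum>R\<in>Pow V. 2 powr l * (w R * (1/2) ^ card (R \<inter> f)))"
    unfolding sum.distrib by (intro arg_cong2[where f = "(+)"] sum.swap)
  also have "\<dots> = (\<Sum>e\<in>H. p ^ k / l) + (\<Sum>f\<in>F. 2 powr l * (1 - p / 2) ^ b)"
    unfolding sum_divide_distrib[symmetric] sum_distrib_left[symmetric]
    by (intro arg_cong2[where f = "(+)"] sum.cong) (auto simp: edge hit)
  also have "\<dots> < 1" using small by simp
  finally have avg: "(\<Sum>R\<in>Pow V. w R * \<Phi> R) < (\<Sum>R\<in>Pow V. w R)" using w1 by simp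
  have "\<exists>R. \<Phi> R < 1"
  proof (rule ccontr)
    assume "\<nexists>R. \<Phi> R < 1"
    then have "w R \<le> w R * \<Phi> R" for R using w0[of R] mult_left_mono[of 1 "\<Phi> R" "w R"]
      by (simp add: not_less)
    then show False using avg sum_mono[of "Pow V" w "\<lambda>R. w R * \<Phi> R"] by fastforce
  qed
  then obtain R where R: "\<Phi> R < 1" by blast
  show ?thesis
  proof (rule independent_transversal_deletion[of H F R])
    fix e assume "e \<in> H" then show "e \<noteq> {}" using H(2) \<open>0 < k\<close> by fastforce
  next
    fix f assume f: "f \<in> F"
    have s0: "0 \<le> (\<Sum>f\<in>F. 2 powr l * (1/2) ^ card (R \<inter> f))" by (intro sum_nonneg) auto
    have c0: "0 \<le> card {e \<in> H. e \<subseteq> R} / l" using l by simp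
    have "card {e \<in> H. e \<subseteq> R} / l < 1" using R s0 unfolding \<Phi>_def by linarith
    then have less: "card {e \<in> H. e \<subseteq> R} < l" using l by simp
    have "2 powr l * (1/2) ^ card (R \<inter> f) \<le> (\<Sum>f\<in>F. 2 powr l * (1/2) ^ card (R \<inter> f))"
      using member_le_sum[OF f, of "\<lambda>f. 2 powr l * (1/2) ^ card (R \<inter> f)"] F(1) by auto
    also have "\<dots> < 1" using R c0 unfolding \<Phi>_def by linarith
    finally have "2 powr l < 2 ^ card (R \<inter> f)" by (simp add: field_simps power_divide)
    also have "\<dots> = 2 powr card (R \<inter> f)" by (simp add: powr_realpow)
    finally show "card {e \<in> H. e \<subseteq> R} < card (R \<inter> f)" using less by simp
  qed (use H F in auto)
qed

section \<open>Constraints on the parameters of non-choosable graphs\<close>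

text \<open>Deletion with \<open>R\<close> the set of all colours: fewer than \<open>b\<close>
  deleted colours cannot exhaust a list of size \<open>b\<close>.\<close>

lemma not_K_choosable_imp_le:
  assumes nch: "\<not> K_choosable m n k b" and pos: "0 < m" "0 < n" "0 < k"
  shows "b \<le> m"
proof (rule ccontr)
  assume less: "\<not> b \<le> m"
  obtain H F :: "nat set set" where
    H: "finite H" "H \<noteq> {}" "card H \<le> m" "\<And>e. e \<in> H \<Longrightarrow> finite e \<and> card e = k" and
    F: "finite F" "F \<noteq> {}" "card F \<le> n" "\<And>f. f \<in> F \<Longrightarrow> finite f \<and> card f = b" and
    no: "\<nexists>S. independent_transversal H F S"
    by (rule not_K_choosable_hypergraphs[OF nch pos(1,2)]) blast
  have "\<exists>S. independent_transversal H F S"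
  proof (rule independent_transversal_deletion[of H F UNIV])
    fix e assume "e \<in> H" then show "e \<noteq> {}" using H(4) pos(3) by fastforce
  next
    fix f assume "f \<in> F" then show "card {e \<in> H. e \<subseteq> UNIV} < card (UNIV \<inter> f)"
      using F(4) H(3) less by simp
  qed (use H F in auto)
  then show False using no by blast
qed

text \<open>Against a single list, one colour of that list suffices as \<open>S\<close>, since edges
  have at least two elements. This makes \<open>ln n\<close> positive.\<close>

lemma not_K_choosable_imp_ge_2:
  assumes nch: "\<not> K_choosable m n k b" and pos: "0 < m" "0 < n" "0 < b" and k: "2 \<le> k"
  shows "2 \<le> n"
proof (rule ccontr)
  assume n: "\<not> 2 \<le> n"
  obtain H F :: "nat set set" where
    H: "finite H" "H \<noteq> {}" "card H \<le> m" "\<And>e. e \<in> H \<Longrightarrow> finite e \<and> card e = k" and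
    F: "finite F" "F \<noteq> {}" "card F \<le> n" "\<And>f. f \<in> F \<Longrightarrow> finite f \<and> card f = b" and
    no: "\<nexists>S. independent_transversal H F S"
    by (rule not_K_choosable_hypergraphs[OF nch pos(1,2)]) blast
  have "0 < card F" using F by (simp add: card_gt_0_iff)
  then have "card F = 1" using F(3) n by linarith
  then obtain f where f: "F = {f}" by (auto simp: card_1_singleton_iff)
  then obtain c where c: "c \<in> f" using F(4) pos(3) by fastforce
  have "\<not> e \<subseteq> {c}" if "e \<in> H" for e
    using H(4)[OF that] k card_mono[of "{c}" e] by auto
  then have "independent_transversal H F {c}"
    using c f unfolding independent_transversal_def by auto
  then show False using no by blast
qed

text \<open>What matters is a positive bound uniform in \<open>m\<close>, \<open>n\<close> and
  \<open>b\<close>. For \<open>k = 1\<close>, and for short lists with \<open>b < 8 * ln n\<close>,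
  it follows from \<open>b \<le> m\<close>; long lists are handled by the random set. The factor
  \<open>8 ^ k\<close> comes from its density, and the 2 keeps the edge term below 1/2.\<close>

lemma not_K_choosable_imp_xi_ge:
  assumes nch: "\<not> K_choosable m n k b" and pos: "0 < m" "0 < n" "0 < b" "0 < k"
  shows "1 / (2 * 8 ^ k) \<le> xi n m k b"
proof (rule ccontr)
  assume "\<not> 1 / (2 * 8 ^ k) \<le> xi n m k b"
  then have small: "xi n m k b < 1 / (2 * 8 ^ k)" by simp
  have bm: "b \<le> m" by (rule not_K_choosable_imp_le[OF nch pos(1,2,4)])
  show False
  proof (cases "k = 1")
    case True
    then show False using small bm pos(3) by (simp add: xi_def field_simps)
  next
    case False
    with pos(4) have k: "2 \<le> k" by simp
    then have n: "2 \<le> n" by (rule not_K_choosable_imp_ge_2[OF nch pos(1-3)])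
    define l where "l = ln (real n)"
    have l: "0 < l" unfolding l_def using n by simp
    have kk: "x ^ k = x * x ^ (k - 1)" for x :: real
      using pos(4) by (metis power_eq_if not_gr_zero)
    show False
    proof (cases "8 * l \<le> b")
      case False
      have "1 / (2 * 8 ^ k) \<le> (1 / 8 :: real) ^ (k - 1)"
        unfolding kk by (simp add: power_one_over field_simps)
      also have "\<dots> \<le> (l / b) ^ (k - 1)"
        using False pos(3) by (intro power_mono) (auto simp: field_simps)
      also have "\<dots> = b * l ^ (k - 1) / b ^ k"
        using pos(3) by (simp add: kk power_divide)
      also have "\<dots> \<le> m * l ^ (k - 1) / b ^ k"
        using bm l by (intro divide_right_mono mult_right_mono) auto
      finally show False using small by (simp add: xi_def l_def)
    next
      case True
      obtain H F :: "nat set set" where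
        H: "finite H" "H \<noteq> {}" "card H \<le> m" "\<And>e. e \<in> H \<Longrightarrow> finite e \<and> card e = k" and
        F: "finite F" "F \<noteq> {}" "card F \<le> n" "\<And>f. f \<in> F \<Longrightarrow> finite f \<and> card f = b" and
        no: "\<nexists>S. independent_transversal H F S"
        by (rule not_K_choosable_hypergraphs[OF nch pos(1,2)]) blast
      \<comment> \<open>The constant 8 makes \<open>(1 - p / 2) ^ b\<close> at most
        \<open>1 / n ^ 4\<close>, which outweighs both the number of lists and the factor
        \<open>2 powr l \<le> n\<close>.\<close>
      define p where "p = 8 * l / b"
      have p: "0 \<le> p" "p \<le> 1" using l True pos(3) by (auto simp: p_def)
      have "card H * p ^ k / l \<le> m * p ^ k / l"
        using H(3) p l by (intro divide_right_mono mult_right_mono) auto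
      also have "\<dots> = 8 ^ k * xi n m k b"
        using l pos(3) unfolding p_def xi_def l_def[symmetric]
        by (simp add: power_divide power_mult_distrib kk)
      also have "\<dots> < 1 / 2" using small by (simp add: field_simps)
      finally have 1: "card H * p ^ k / l < 1 / 2" .
      have "2 powr l \<le> exp l"
        using ln_2_less_1 l by (simp add: powr_def)
      then have a: "2 powr l \<le> n" using n by (simp add: l_def)
      have "(1 - p / 2) ^ b \<le> exp (- (p / 2)) ^ b"
        using p exp_ge_add_one_self[of "- (p / 2)"] by (intro power_mono) auto
      also have "\<dots> = exp (- (4 * l))"
        using pos(3) unfolding exp_of_nat_mult[symmetric] p_def by simp
      also have "\<dots> = 1 / n ^ 4"
        using n exp_of_nat_mult[of 4 l] unfolding exp_minus l_def by (simp add: inverse_eq_divide)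
      finally have c: "(1 - p / 2) ^ b \<le> 1 / n ^ 4" .
      have "card F * (2 powr l * (1 - p / 2) ^ b) \<le> n * (n * (1 / n ^ 4))"
        using F(3) a c p by (intro mult_mono) auto
      also have "\<dots> = 1 / n ^ 2" using n by (simp add: field_simps eval_nat_numeral)
      also have "\<dots> \<le> 1 / 2 ^ 2" using n power_mono[of 2 "real n" 2] by (simp add: field_simps)
      finally have "card F * (2 powr l * (1 - p / 2) ^ b) \<le> 1 / 4" by simp
      with 1 have "card H * p ^ k / l + card F * (2 powr l * (1 - p / 2) ^ b) < 1" by linarith
      then show False
        using independent_transversal_random[OF H(1,4) pos(4) F(1,4) p l] no by blast
    qed
  qed
qed

section \<open>The infimum \<open>xi_m\<close>\<close>

text \<open>One vertex with list \<open>{..<k}\<close> faces \<open>k\<close> vertices whose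
  singleton lists block all its colours. Hence the infimum is over a nonempty set.\<close>

lemma not_K_choosable_singletons: "0 < k \<Longrightarrow> \<not> K_choosable 1 k k 1"
proof
  assume k: "0 < k" and ch: "K_choosable 1 k k 1"
  have "\<exists>S. independent_transversal {{..<k}} ((\<lambda>i. {i}) ` {..<k}) S"
    by (rule K_choosable_independent_transversal[OF ch])
      (use k card_image_le[of "{..<k}" "\<lambda>i. {i}"] in auto)
  then show False unfolding independent_transversal_def by auto
qed

lemma xi_m_le:
  assumes "\<not> K_choosable m n k b" "0 < m" "0 < n" "0 < b"
  shows "xi_m k \<le> xi n m k b"
  unfolding xi_m_def
proof (rule cInf_lower)
  show "bdd_below {xi \<Delta>A \<Delta>B k kB |\<Delta>A \<Delta>B kB.
      0 < \<Delta>A \<and> 0 < \<Delta>B \<and> 0 < kB \<and> \<not> K_choosable \<Delta>B \<Delta>A k kB}"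
    by (rule bdd_belowI[of _ 0]) (auto simp: xi_def)
qed (use assms in blast)

lemma xi_m_nonempty:
  assumes "0 < k"
  shows "{xi \<Delta>A \<Delta>B k kB |\<Delta>A \<Delta>B kB.
      0 < \<Delta>A \<and> 0 < \<Delta>B \<and> 0 < kB \<and> \<not> K_choosable \<Delta>B \<Delta>A k kB} \<noteq> {}"
  using not_K_choosable_singletons[OF assms] assms by (metis (mono_tags, lifting) empty_Collect_eq zero_less_one)

lemma xi_m_pos:
  assumes "0 < k"
  shows "0 < xi_m k"
proof -
  have "1 / (2 * 8 ^ k) \<le> xi_m k"
    unfolding xi_m_def
    by (rule cInf_greatest[OF xi_m_nonempty[OF assms]])
      (use not_K_choosable_imp_xi_ge assms in blast)
  moreover have "0 < 1 / (2 * 8 ^ k :: real)" by simp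
  ultimately show ?thesis by linarith
qed

text \<open>The bound \<open>2 \<le> n\<close> is there because \<open>D_le_blowup\<close> divides
  by \<open>ln n\<close>. For \<open>k = 1\<close> the value of \<open>xi\<close> does not depend on
  \<open>n\<close>, so \<open>n\<close> can be raised.\<close>

lemma xi_m_less_obtains:
  assumes k: "0 < k" and less: "xi_m k < a"
  obtains m n b where "\<not> K_choosable m n k b" "0 < m" "2 \<le> n" "0 < b" "xi n m k b < a"
proof -
  obtain n m b where nmb: "0 < n" "0 < m" "0 < b" "\<not> K_choosable m n k b" "xi n m k b < a"
    using cInf_lessD[OF xi_m_nonempty[OF k] less[unfolded xi_m_def]] by blast
  show thesis
  proof (cases "k = 1")
    case True
    have "\<not> K_choosable m (Suc n) k b"
      by (rule not_K_choosable_mono[OF nmb(4,2,1)]) auto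
    moreover have "xi (Suc n) m k b < a" using nmb(5) True by (simp add: xi_def)
    ultimately show thesis using nmb by (intro that[of m "Suc n" b]) auto
  next
    case False
    then have "2 \<le> n" using not_K_choosable_imp_ge_2[OF nmb(4,2,1,3)] k by simp
    then show thesis using nmb that by blast
  qed
qed

section \<open>Asymptotics of the diagonal\<close>

text \<open>One diagonal example guarantees that the \<open>LEAST\<close> in \<open>D\<close> is
  attained.\<close>

lemma D_le:
  assumes "0 < \<Delta>" "\<not> K_choosable \<Delta> \<Delta> k b"
  shows "D k b \<le> \<Delta>" "0 < D k b" "\<not> K_choosable (D k b) (D k b) k b"
proof -
  let ?P = "\<lambda>\<Delta>. 0 < \<Delta> \<and> \<not> K_choosable \<Delta> \<Delta> k b"
  show "D k b \<le> \<Delta>" unfolding D_def by (rule Least_le) (use assms in simp)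
  have "?P (D k b)" unfolding D_def by (rule LeastI[of ?P \<Delta>]) (use assms in simp)
  then show "0 < D k b" "\<not> K_choosable (D k b) (D k b) k b" by auto
qed

text \<open>
  The number \<open>t\<close> of copies is chosen just below \<open>ln \<Delta> / ln n\<close> for the expected order of
  magnitude of \<open>\<Delta>\<close>, so that \<open>n ^ t\<close> is of smaller order than \<open>\<Delta>\<close>; then \<open>s\<close> is the least
  number of clones that makes the lists long enough.
\<close>

lemma D_le_blowup:
  fixes k b m n b0 :: nat and x :: real
  assumes nch: "\<not> K_choosable m n k b0" and pos: "0 < m" "2 \<le> n" "0 < b0" "0 < k"
    and b: "1 < ln (real b)"
    and x: "x = (k * ln b - k * ln (ln b)) / ln n" "2 \<le> x"
  shows "0 < D k b" "\<not> K_choosable (D k b) (D k b) k b"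
    "D k b * (k * ln b) ^ (k - 1) / b ^ k \<le>
       max (((b + x * b0) / b) ^ k * (m / b0 ^ k) * (k * ln b / (x - 1)) ^ (k - 1))
           (k ^ (k - 1) / ln b)"
proof -
  define t where "t = nat \<lfloor>x\<rfloor>"
  define s where "s = nat \<lceil>real b / (t * b0)\<rceil>"
  define \<Delta> where "\<Delta> = max (s ^ k * t * m) (n ^ t)"
  have b0: "0 < b" using b by (cases "b = 0") auto
  have t: "real t \<le> x" "x - 1 \<le> real t" "0 < t"
    unfolding t_def using x(2) by linarith+
  have tb: "0 < real t * real b0" using t pos by simp
  have "0 < real b / (t * b0)" using tb b0 by simp
  then have s: "real b / (t * b0) \<le> s" "s \<le> real b / (t * b0) + 1" "0 < s"
    unfolding s_def by linarith+
  have "real b \<le> real (s * t * b0)"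
    using s(1) tb by (simp add: field_simps)
  then have bl: "b \<le> s * t * b0" by (simp only: of_nat_le_iff)
  have "\<not> K_choosable (s ^ k * t * m) (n ^ t) k (s * t * b0)"
    by (rule not_K_choosable_blowup[OF nch]) (use pos s t in auto)
  then have "\<not> K_choosable \<Delta> \<Delta> k b"
    by (rule not_K_choosable_mono) (use pos s t bl in \<open>auto simp: \<Delta>_def\<close>)
  moreover have "0 < \<Delta>" unfolding \<Delta>_def using pos by (simp add: less_max_iff_disj)
  ultimately have D: "D k b \<le> \<Delta>" "0 < D k b" "\<not> K_choosable (D k b) (D k b) k b"
    using D_le by blast+
  show "0 < D k b" "\<not> K_choosable (D k b) (D k b) k b" by fact+
  have kk: "y ^ k = y * y ^ (k - 1)" for y :: real
    using pos(4) by (metis power_eq_if not_gr_zero)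
  \<comment> \<open>\<open>L\<close> is the reciprocal of the expected order of magnitude of
    \<open>D k b\<close>.\<close>
  define L where "L = (k * ln b) ^ (k - 1) / real b ^ k"
  have L: "0 \<le> L" unfolding L_def using b by simp
  \<comment> \<open>The subtracted \<open>k * ln (ln b)\<close> in \<open>x\<close> brings
    \<open>n ^ t\<close> down to \<open>b ^ k / ln b ^ k\<close>, a factor of order
    \<open>ln b\<close> below the target.\<close>
  have "real (n ^ t) = exp (t * ln n)"
    using pos(2) by (simp add: exp_of_nat_mult)
  also have "\<dots> \<le> exp (x * ln n)" using t(1) pos(2) by (simp add: mult_right_mono)
  also have "x * ln n = k * ln b - k * ln (ln b)" using x(1) pos(2) by simp
  also have "exp \<dots> = b ^ k / ln b ^ k"
  proof -
    have "exp (ln (ln (real b))) = ln b" using b by (intro exp_ln) linarith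
    then show ?thesis using b0 by (simp add: exp_diff exp_of_nat_mult)
  qed
  finally have "real (n ^ t) * L \<le> b ^ k / ln b ^ k * L" using L by (rule mult_right_mono)
  also have "\<dots> = k ^ (k - 1) / ln b"
    using b b0 unfolding L_def by (simp add: power_mult_distrib kk)
  finally have 2: "real (n ^ t) * L \<le> k ^ (k - 1) / ln b" .
  have "real s \<le> (b + x * b0) / (t * b0)"
  proof -
    have "s \<le> (b + t * b0) / (t * b0)" using s(2) t(3) pos(3) by (simp add: add_divide_distrib)
    also have "\<dots> \<le> (b + x * b0) / (t * b0)"
      using mult_right_mono[OF t(1), of "real b0"] by (intro divide_right_mono) auto
    finally show ?thesis .
  qed
  then have "real s ^ k \<le> ((b + x * b0) / (t * b0)) ^ k" by (intro power_mono) auto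
  then have "real (s ^ k * t * m) \<le> ((b + x * b0) / (t * b0)) ^ k * t * m"
    by (simp add: mult_right_mono)
  \<comment> \<open>One of the \<open>k\<close> factors \<open>1 / t\<close> cancels against the
    \<open>t\<close> copies; the remaining \<open>k - 1\<close> produce the power of the
    logarithm.\<close>
  also have "\<dots> = (b + x * b0) ^ k * (m / b0 ^ k) * (1 / t ^ (k - 1))"
  proof -
    have "real t ^ k = real t * real t ^ (k - 1)" by (rule kk)
    then show ?thesis using t by (simp add: power_divide power_mult_distrib field_simps)
  qed
  also have "\<dots> \<le> (b + x * b0) ^ k * (m / b0 ^ k) * (1 / (x - 1) ^ (k - 1))"
    using t x(2) power_mono[OF t(2), of "k - 1"]
    by (intro mult_left_mono divide_left_mono mult_pos_pos) auto
  finally have "real (s ^ k * t * m) * L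
      \<le> (b + x * b0) ^ k * (m / b0 ^ k) * (1 / (x - 1) ^ (k - 1)) * L"
    using L by (rule mult_right_mono)
  also have "\<dots> = ((b + x * b0) / b) ^ k * (m / b0 ^ k) * (k * ln b / (x - 1)) ^ (k - 1)"
    unfolding L_def power_divide by simp
  finally have 1: "real (s ^ k * t * m) * L
      \<le> ((b + x * b0) / b) ^ k * (m / b0 ^ k) * (k * ln b / (x - 1)) ^ (k - 1)" .
  have "D k b * (k * ln b) ^ (k - 1) / b ^ k = D k b * L" unfolding L_def by simp
  also have "\<dots> \<le> \<Delta> * L" using D(1) L by (intro mult_right_mono) auto
  also have "\<dots> = max (real (s ^ k * t * m) * L) (real (n ^ t) * L)"
    unfolding \<Delta>_def using L by (simp add: max_mult_distrib_right of_nat_max)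
  also have "\<dots> \<le> max (((b + x * b0) / b) ^ k * (m / b0 ^ k) * (k * ln b / (x - 1)) ^ (k - 1))
           (k ^ (k - 1) / ln b)"
    using 1 2 by (rule max.mono)
  finally show "D k b * (k * ln b) ^ (k - 1) / b ^ k \<le>
       max (((b + x * b0) / b) ^ k * (m / b0 ^ k) * (k * ln b / (x - 1)) ^ (k - 1))
           (k ^ (k - 1) / ln b)" .
qed

text \<open>Blow up a fixed example with \<open>xi\<close> below \<open>a\<close>: as
  \<open>b\<close> grows, the first term of the maximum tends to that \<open>xi\<close> and the
  second to 0. Non-choosability at \<open>D k b\<close> is recorded for use in
  \<open>D_lower\<close>.\<close>

lemma D_upper:
  assumes k: "0 < k" and a: "xi_m k < a"
  shows "\<forall>\<^sub>F b in sequentially. 0 < D k b \<and> \<not> K_choosable (D k b) (D k b) k b \<and>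
    D k b * (k * ln b) ^ (k - 1) / b ^ k < a"
proof -
  obtain m n b0 where ex: "\<not> K_choosable m n k b0" "0 < m" "2 \<le> n" "0 < b0" "xi n m k b0 < a"
    using xi_m_less_obtains[OF k a] .
  define l where "l = ln (real n)"
  define x where "x b = (k * ln (real b) - k * ln (ln (real b))) / l" for b :: nat
  have l: "0 < l" unfolding l_def using ex by simp
  have k': "0 < real k" using k by simp
  have b0': "0 < real b0" using ex by simp
  have ev1: "\<forall>\<^sub>F b :: nat in sequentially. 1 < ln (real b)" by real_asymp
  have ev2: "\<forall>\<^sub>F b in sequentially. 2 \<le> x b"
    unfolding x_def using l k' by real_asymp
  \<comment> \<open>\<open>x b\<close> is asymptotic to \<open>k * ln b / l\<close>, hence
    negligible against \<open>b\<close>.\<close>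
  have lim1: "(\<lambda>b. (real b + x b * b0) / b) \<longlonglongrightarrow> 1"
    unfolding x_def using l k' b0' by real_asymp
  have lim2: "(\<lambda>b. k * ln (real b) / (x b - 1)) \<longlonglongrightarrow> l"
    unfolding x_def using l k' by real_asymp
  have "(\<lambda>b. ((real b + x b * b0) / b) ^ k * (m / b0 ^ k) * (k * ln (real b) / (x b - 1)) ^ (k - 1))
      \<longlonglongrightarrow> 1 ^ k * (m / b0 ^ k) * l ^ (k - 1)"
    by (intro tendsto_intros lim1 lim2)
  also have "1 ^ k * (m / b0 ^ k) * l ^ (k - 1) = xi n m k b0"
    by (simp add: xi_def l_def)
  finally have ev3: "\<forall>\<^sub>F b in sequentially.
      ((real b + x b * b0) / b) ^ k * (m / b0 ^ k) * (k * ln (real b) / (x b - 1)) ^ (k - 1) < a"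
    using ex(5) order_tendstoD(2) by blast
  have "(\<lambda>b. real k ^ (k - 1) / ln (real b)) \<longlonglongrightarrow> 0" by real_asymp
  then have ev4: "\<forall>\<^sub>F b :: nat in sequentially. real k ^ (k - 1) / ln (real b) < a"
    using order_tendstoD(2) xi_m_pos[OF k] a by (metis order_less_trans)
  show ?thesis
    using ev1 ev2 ev3 ev4
  proof eventually_elim
    case (elim b)
    note D = D_le_blowup[OF ex(1-4) k elim(1) x_def[of b, unfolded l_def] elim(2)]
    have "D k b * (k * ln b) ^ (k - 1) / b ^ k < a"
      by (rule le_less_trans[OF D(3)]) (use elim(3,4) in simp)
    with D(1,2) show ?case by blast
  qed
qed

text \<open>The value of \<open>xi\<close> at the diagonal example \<open>D k b\<close> is at least
  \<open>xi_m k\<close>; it has \<open>ln (D k b)\<close> where the claim has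
  \<open>k * ln b\<close>. \<open>D_upper\<close> bounds the former by the latter plus
  \<open>ln C\<close>, which is negligible in the limit.\<close>

lemma D_lower:
  assumes k: "0 < k" and a: "a < xi_m k"
  shows "\<forall>\<^sub>F b in sequentially. a < D k b * (k * ln b) ^ (k - 1) / b ^ k"
proof -
  define C where "C = xi_m k + 1"
  have C: "1 \<le> C" "xi_m k < C" unfolding C_def using xi_m_pos[OF k] by auto
  have k': "0 < real k" using k by simp
  have "(\<lambda>b. k * ln (real b) / (k * ln (real b) + ln C)) \<longlonglongrightarrow> 1" using k' by real_asymp
  then have "(\<lambda>b. xi_m k * (k * ln (real b) / (k * ln (real b) + ln C)) ^ (k - 1))
      \<longlonglongrightarrow> xi_m k * 1 ^ (k - 1)"
    by (intro tendsto_intros)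
  then have ev1: "\<forall>\<^sub>F b :: nat in sequentially.
      a < xi_m k * (k * ln (real b) / (k * ln (real b) + ln C)) ^ (k - 1)"
    using a order_tendstoD(1) by fastforce
  have ev2: "\<forall>\<^sub>F b :: nat in sequentially. 1 < ln (real b)" by real_asymp
  show ?thesis
    using ev1 ev2 D_upper[OF k C(2)]
  proof eventually_elim
    case (elim b)
    have b: "0 < b" using elim(2) by (cases "b = 0") auto
    have D: "0 < D k b" using elim(3) by blast
    have "1 * ln b \<le> k * ln b" using elim(2) k by (intro mult_right_mono) auto
    then have u: "1 < k * ln b" using elim(2) by linarith
    have lC: "0 \<le> ln C" using C by simp
    \<comment> \<open>Only \<open>ln (D k b)\<close> is being estimated, so a factor that is at
      least 1 can be inserted at no cost.\<close>
    have "D k b \<le> D k b * (k * ln b) ^ (k - 1)"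
      using u mult_left_mono[OF one_le_power, of "k * ln b" "real (D k b)" "k - 1"] by simp
    also have "\<dots> \<le> C * b ^ k" using elim(3) b by (simp add: field_simps)
    finally have "ln (D k b) \<le> ln (C * b ^ k)" using D by (subst ln_le_cancel_iff) (use C b in auto)
    also have "\<dots> = k * ln b + ln C" using C b by (simp add: ln_mult ln_realpow)
    finally have lnD: "ln (D k b) \<le> k * ln b + ln C" .
    have "xi_m k \<le> D k b * ln (D k b) ^ (k - 1) / b ^ k"
      using xi_m_le[of "D k b" "D k b" k b] elim(3) b unfolding xi_def by simp
    also have "\<dots> \<le> D k b * (k * ln b + ln C) ^ (k - 1) / b ^ k"
      using lnD D by (intro divide_right_mono mult_left_mono power_mono) auto
    \<comment> \<open>Multiplying by this ratio, which tends to 1, replaces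
      \<open>k * ln b + ln C\<close> by \<open>k * ln b\<close> on the right.\<close>
    finally have "xi_m k * (k * ln b / (k * ln b + ln C)) ^ (k - 1)
        \<le> D k b * (k * ln b + ln C) ^ (k - 1) / b ^ k * (k * ln b / (k * ln b + ln C)) ^ (k - 1)"
      using u lC by (intro mult_right_mono) auto
    also have "\<dots> = D k b * (k * ln b) ^ (k - 1) / b ^ k"
      using u lC by (simp add: power_divide)
    finally show ?case using elim(1) by simp
  qed
qed

theorem theorem1p6:
  fixes kA :: nat
  assumes "0 < kA"
  shows "(\<lambda>kB. real (D kA kB) /
            (xi_m kA * real kB ^ kA / (real kA * ln (real kB)) ^ (kA - 1))) \<longlonglongrightarrow> 1"
proof -
  have "(\<lambda>b. D kA b * (kA * ln b) ^ (kA - 1) / b ^ kA) \<longlonglongrightarrow> xi_m kA"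
  proof (rule order_tendstoI)
    fix a assume "a < xi_m kA"
    then show "\<forall>\<^sub>F b in sequentially. a < D kA b * (kA * ln b) ^ (kA - 1) / b ^ kA"
      by (rule D_lower[OF assms])
  next
    fix a assume "xi_m kA < a"
    from D_upper[OF assms this]
    show "\<forall>\<^sub>F b in sequentially. D kA b * (kA * ln b) ^ (kA - 1) / b ^ kA < a"
      by eventually_elim blast
  qed
  \<comment> \<open>Positivity of \<open>xi_m kA\<close> is what turns the limit of the normalised
    \<open>D\<close> into an asymptotic equivalence.\<close>
  then have "(\<lambda>b. D kA b * (kA * ln b) ^ (kA - 1) / b ^ kA / xi_m kA) \<longlonglongrightarrow> xi_m kA / xi_m kA"
    by (intro tendsto_intros) (use xi_m_pos[OF assms] in auto)
  then show ?thesis using xi_m_pos[OF assms] by (simp add: field_simps)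
qed

end
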